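(* For all integers $k\ge1$ and $n\ge1$, $$N^{(k-1)(k-2)\cdots1k}_{21\text{-}3}(n)=\begin{cases}0,&\text{if }k\ge3,\\ B_n-B_{n-1},&\text{if }k=2,\\ B_n,&\text{if }k=1.\end{cases}$$
   Context: A permutation $\pi=\pi_1\cdots\pi_n$ of $\{1,\dots,n\}$ contains the generalized pattern $21\text{-}3$ if there are indices $i,j$ with $i+1<j\le n$ such that $\pi_i\pi_{i+1}\pi_j$ is order-isomorphic to $213$; otherwise it avoids it. A permutation $\pi$ begins with a pattern $p=p_1\cdots p_k$ if $n\ge k$ and $\pi_1\cdots\pi_k$ is order-isomorphic to $p$. The pattern $(k-1)(k-2)\cdots1k$ consists of $k-1,k-2,\dots,1$ in decreasing order followed by $k$ (for $k=1$ it is $1$, for $k=2$ it is $12$). $N^p_q(n)$ is the number of permutations of $\{1,\dots,n\}$ that avoid $q$ and begin with $p$. $B_m$ is the $m$th Bell number ($B_0=1$). *)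

theory Defs
  imports "HOL-Combinatorics.Multiset_Permutations" "HOL-Library.Disjoint_Sets"
begin

definition order_isomorphic :: "nat list \<Rightarrow> nat list \<Rightarrow> bool" where
  "order_isomorphic xs ys \<longleftrightarrow> length xs = length ys \<and>
     (\<forall>i<length xs. \<forall>j<length xs. xs ! i < xs ! j \<longleftrightarrow> ys ! i < ys ! j)"

(* Positions are counted from 0, and i, i + 1 carry the adjacent letters of the block 21. *)
definition contains_21_3 :: "nat list \<Rightarrow> bool" where
  "contains_21_3 xs \<longleftrightarrow> (\<exists>i j. i + 1 < j \<and> j < length xs \<and>
     order_isomorphic [xs ! i, xs ! (i + 1), xs ! j] [2, 1, 3])"

definition begins_with :: "nat list \<Rightarrow> nat list \<Rightarrow> bool" where
  "begins_with xs p \<longleftrightarrow> length p \<le> length xs \<and> order_isomorphic (take (length p) xs) p"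

(* The pattern (k-1)(k-2)...1k. *)
definition decreasing_then_max :: "nat \<Rightarrow> nat list" where
  "decreasing_then_max k = rev [1..<k] @ [k]"

lemma decreasing_then_max_small:
  "decreasing_then_max 1 = [1]" "decreasing_then_max 2 = [1, 2]"
  "decreasing_then_max 3 = [2, 1, 3]" "decreasing_then_max 4 = [3, 2, 1, 4]"
  by (simp_all add: decreasing_then_max_def upt_rec)

(* Permutations of {1,...,n} in one-line notation. *)
definition N_21_3 :: "nat list \<Rightarrow> nat \<Rightarrow> nat" where
  "N_21_3 p n =
     card {xs \<in> permutations_of_set {1..n}. \<not> contains_21_3 xs \<and> begins_with xs p}"

definition Bell :: "nat \<Rightarrow> nat" where
  "Bell m = card {P. partition_on {1..m} P}"

lemma Bell_0: "Bell 0 = 1"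
  by (simp add: Bell_def partition_on_empty)

end

theory Submission
  imports Defs
begin

text \<open>
  If \<open>m\<close> is the largest letter of \<open>\<sigma> m \<tau>\<close>, then every descent inside \<open>\<sigma>\<close> is completed to a
  \<open>21-3\<close> by \<open>m\<close>, while a descent from \<open>m\<close> cannot be completed. So \<open>\<sigma> m \<tau>\<close> avoids \<open>21-3\<close> iff
  \<open>\<sigma>\<close> is increasing and \<open>\<tau>\<close> avoids \<open>21-3\<close>, and an avoider on \<open>S\<close> is given by the set \<open>A\<close> of
  letters before \<open>m\<close> and an avoider on \<open>S - {m} - A\<close>. Partitions of \<open>S\<close> satisfy the same
  recursion, \<open>A \<union> {m}\<close> being the block of \<open>m\<close>. An avoider starting with a descent starts with
  its largest letter, and deleting that letter leaves an arbitrary avoider.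
\<close>

section \<open>Occurrences of 21-3 when letters are prepended\<close>

lemma contains_21_3_iff:
  "contains_21_3 xs \<longleftrightarrow>
     (\<exists>i j. i + 1 < j \<and> j < length xs \<and> xs ! (i + 1) < xs ! i \<and> xs ! i < xs ! j)"
proof -
  have "order_isomorphic [a, b, c] [2, 1, 3] \<longleftrightarrow> b < a \<and> a < c" for a b c
    by (auto simp: order_isomorphic_def less_Suc_eq numeral_3_eq_3)
  then show ?thesis
    by (simp add: contains_21_3_def)
qed

lemma not_contains_21_3_Nil [simp]: "\<not> contains_21_3 []"
  and not_contains_21_3_single [simp]: "\<not> contains_21_3 [x]"
  by (auto simp: contains_21_3_iff)

text \<open>An occurrence with \<open>i = 0\<close> has its third letter in \<open>zs\<close>, since
  \<open>j\<close> is at least 2; every other occurrence shifts by one position and lies in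
  \<open>y # zs\<close>.\<close>

lemma contains_21_3_Cons_Cons:
  "contains_21_3 (x # y # zs) \<longleftrightarrow> y < x \<and> (\<exists>z\<in>set zs. x < z) \<or> contains_21_3 (y # zs)"
  (is "?L \<longleftrightarrow> ?R")
proof
  assume ?L
  then obtain i j where ij: "i + 1 < j" "j < length (x # y # zs)"
    and "(x # y # zs) ! (i + 1) < (x # y # zs) ! i" "(x # y # zs) ! i < (x # y # zs) ! j"
    by (auto simp: contains_21_3_iff)
  then show ?R
  proof (cases i)
    case 0
    with ij obtain j' where "j = Suc (Suc j')"
      by (metis One_nat_def add_0 less_imp_Suc_add plus_1_eq_Suc add_Suc)
    with 0 ij \<open>_ < _ ! i\<close> \<open>_ ! i < _\<close> show ?thesis
      by auto
  next
    case (Suc i')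
    with ij obtain j' where "j = Suc j'"
      by (cases j) auto
    with Suc ij \<open>_ < _ ! i\<close> \<open>_ ! i < _\<close> show ?thesis
      unfolding contains_21_3_iff by (intro disjI2 exI[of _ i'] exI[of _ j']) auto
  qed
next
  assume ?R
  then show ?L
  proof
    assume "y < x \<and> (\<exists>z\<in>set zs. x < z)"
    then obtain k where "y < x" "k < length zs" "x < zs ! k"
      by (auto simp: in_set_conv_nth)
    then show ?L
      unfolding contains_21_3_iff by (intro exI[of _ 0] exI[of _ "Suc (Suc k)"]) auto
  next
    assume "contains_21_3 (y # zs)"
    then obtain i j where "i + 1 < j" "j < length (y # zs)"
      "(y # zs) ! (i + 1) < (y # zs) ! i" "(y # zs) ! i < (y # zs) ! j"
      by (auto simp: contains_21_3_iff)
    then show ?L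
      unfolding contains_21_3_iff by (intro exI[of _ "Suc i"] exI[of _ "Suc j"]) auto
  qed
qed

text \<open>A leading maximum could only serve as the 2 of the pattern, and nothing exceeds
  it.\<close>

lemma contains_21_3_max_Cons:
  assumes "\<forall>y\<in>set ys. y < m"
  shows "contains_21_3 (m # ys) \<longleftrightarrow> contains_21_3 ys"
  using assms by (cases ys) (auto simp: contains_21_3_Cons_Cons)

lemma contains_21_3_append_max_Cons:
  assumes "\<forall>x\<in>set xs. x < m" and "\<forall>y\<in>set ys. y < m"
  shows "\<not> contains_21_3 (xs @ m # ys) \<longleftrightarrow> sorted xs \<and> \<not> contains_21_3 ys"
  using assms(1)
proof (induction xs)
  case Nil
  then show ?case
    using assms(2) by (simp add: contains_21_3_max_Cons)
next
  case (Cons x xs)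
  \<comment> \<open>If \<open>xs\<close> is nonempty, a descent from \<open>x\<close> to its head is
    completed by \<open>m\<close>; without that descent, transitivity carries the bound
    \<open>x\<close> from the head to all of the sorted \<open>xs\<close>.\<close>
  then show ?case
    by (cases xs) (auto simp: contains_21_3_Cons_Cons not_less intro: order_trans[of x])
qed

section \<open>Avoiders on a set of letters\<close>

text \<open>The letters after the maximum can form any subset of the remaining ones; allowing every
  set \<open>S\<close> spares renumbering them as an interval.\<close>

definition avoiders :: "nat set \<Rightarrow> nat list set" where
  "avoiders S = {xs \<in> permutations_of_set S. \<not> contains_21_3 xs}"

lemma finite_avoiders [simp]: "finite (avoiders S)"
  by (simp add: avoiders_def)

lemma card_avoiders_rec:
  assumes "finite S" and "\<forall>x\<in>S. x < m"
  shows "card (avoiders (insert m S)) = (\<Sum>A\<in>Pow S. card (avoiders (S - A)))"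
proof -
  \<comment> \<open>The part before \<open>m\<close> is increasing, so its set \<open>A\<close>
    encodes it.\<close>
  let ?f = "\<lambda>(A, ys). sorted_list_of_set A @ m # ys"
  let ?D = "SIGMA A:Pow S. avoiders (S - A)"
  have inj: "inj_on ?f ?D"
  proof (rule inj_onI, clarify)
    fix A ys B zs
    assume A: "A \<subseteq> S" and B: "B \<subseteq> S" and ys: "ys \<in> avoiders (S - A)"
      and eq: "sorted_list_of_set A @ m # ys = sorted_list_of_set B @ m # zs"
    have fin: "finite A" "finite B"
      using A B assms(1) by (auto intro: finite_subset)
    \<comment> \<open>In the left word \<open>m\<close> occurs only at the cut, so the right word
      must be cut at the same place.\<close>
    have "m \<notin> A" "m \<notin> set ys"
      using A ys assms(2) by (auto simp: avoiders_def permutations_of_set_def)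
    with fin eq have "sorted_list_of_set A = sorted_list_of_set B \<and> ys = zs"
      by (simp add: append_Cons_eq_iff)
    with fin show "A = B \<and> ys = zs"
      by (metis set_sorted_list_of_set)
  qed
  have img: "?f ` ?D = avoiders (insert m S)"
  proof (intro equalityI subsetI)
    fix xs assume "xs \<in> ?f ` ?D"
    then obtain A ys where A: "A \<subseteq> S" and ys: "ys \<in> avoiders (S - A)"
      and xs: "xs = sorted_list_of_set A @ m # ys"
      by auto
    have "finite A"
      using A assms(1) by (rule finite_subset)
    with A ys assms show "xs \<in> avoiders (insert m S)"
      by (subst (asm) avoiders_def, subst avoiders_def)
        (auto simp: xs permutations_of_set_def contains_21_3_append_max_Cons subset_iff)
  next
    fix xs assume xs: "xs \<in> avoiders (insert m S)"
    then have "m \<in> set xs"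
      by (auto simp: avoiders_def permutations_of_set_def)
    then obtain us ys where split: "xs = us @ m # ys"
      by (meson split_list)
    with xs have dist: "distinct us" "distinct ys" "set us \<inter> set ys = {}"
      and un: "set us \<union> set ys = S"
      using assms(2) by (auto simp: avoiders_def permutations_of_set_def)
    then have *: "\<forall>x\<in>set us. x < m" "\<forall>y\<in>set ys. y < m"
      using assms(2) by auto
    have "sorted us" "\<not> contains_21_3 ys"
      using contains_21_3_append_max_Cons[OF *] xs by (auto simp: split avoiders_def)
    \<comment> \<open>An increasing list with distinct entries is the sorted list of its
      set.\<close>
    then have "xs = ?f (set us, ys)" "(set us, ys) \<in> ?D"
      using dist un
      by (auto simp: split avoiders_def permutations_of_set_def sorted_distinct_set_unique)
    then show "xs \<in> ?f ` ?D"
      by blast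
  qed
  have "card (avoiders (insert m S)) = card ?D"
    using card_image[OF inj] unfolding img .
  also have "\<dots> = (\<Sum>A\<in>Pow S. card (avoiders (S - A)))"
    using assms(1) by (subst card_SigmaI) auto
  finally show ?thesis .
qed

section \<open>Set partitions and Bell numbers\<close>

lemma card_partition_on_rec:
  assumes "finite S" and "m \<notin> S"
  shows "card {P. partition_on (insert m S) P} = (\<Sum>A\<in>Pow S. card {P. partition_on (S - A) P})"
proof -
  let ?f = "\<lambda>(A, Q). insert (insert m A) Q"
  let ?D = "SIGMA A:Pow S. {P. partition_on (S - A) P}"
  have inj: "inj_on ?f ?D"
  proof (rule inj_onI, clarify)
    fix A P B Q
    assume "A \<subseteq> S" "B \<subseteq> S" and P: "partition_on (S - A) P" and Q: "partition_on (S - B) Q"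
      and eq: "insert (insert m A) P = insert (insert m B) Q"
    then have m: "m \<notin> A" "m \<notin> B" "\<forall>X\<in>P. m \<notin> X" "\<forall>X\<in>Q. m \<notin> X"
      using assms(2) by (auto simp: partition_on_def)
    \<comment> \<open>No block of \<open>P\<close> or \<open>Q\<close> contains \<open>m\<close>, so
      the inserted block can be recovered as the only one that does.\<close>
    have "insert m A \<in> insert (insert m B) Q"
      by (simp flip: eq)
    moreover have "insert m A \<notin> Q"
      using m(4) by (meson insertI1)
    ultimately have ins: "insert m A = insert m B"
      by (metis insertE)
    with m(1,2) have "A = B"
      by (simp add: insert_ident)
    moreover have "P = Q"
    proof -
      have "insert m A \<notin> P" "insert m A \<notin> Q"
        using m by auto
      then show ?thesis
        using eq ins by (metis insert_ident)
    qed
    ultimately show "A = B \<and> P = Q" ..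
  qed
  have img: "?f ` ?D = {P. partition_on (insert m S) P}"
  proof (intro equalityI subsetI)
    fix P assume "P \<in> ?f ` ?D"
    then obtain A Q where "A \<subseteq> S" and Q: "partition_on (S - A) Q"
      and P: "P = insert (insert m A) Q"
      by auto
    then have "disjnt (insert m A) (\<Union>Q)" "insert m S = insert m A \<union> (S - A)"
      using assms(2) by (auto simp: partition_on_def disjnt_def)
    with Q have "partition_on (insert m S) P"
      unfolding P by (subst partition_on_insert) (auto simp: partition_on_def)
    then show "P \<in> {P. partition_on (insert m S) P}" by simp
  next
    fix P assume "P \<in> {P. partition_on (insert m S) P}"
    then have P: "partition_on (insert m S) P" by simp
    then obtain B where B: "B \<in> P" "m \<in> B"
      by (auto simp: partition_on_def)
    have "B - {m} \<subseteq> S"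
      using P B by (auto simp: partition_on_def)
    moreover have "partition_on (S - (B - {m})) (P - {B})"
    proof -
      \<comment> \<open>As the other blocks are disjoint from \<open>B\<close>, dropping
        \<open>B\<close> removes exactly its points from the union.\<close>
      have "disjnt X B" if "X \<in> P - {B}" for X
        using P B that by (auto simp: partition_on_def disjoint_def disjnt_def)
      then have "\<Union>(P - {B}) = \<Union>P - B"
        by (fastforce simp: disjnt_def)
      also have "\<Union>P = insert m S"
        using P by (simp add: partition_on_def)
      also have "insert m S - B = S - (B - {m})"
        using B assms(2) by blast
      finally have "\<Union>(P - {B}) = S - (B - {m})" .
      with P show ?thesis
        by (auto simp: partition_on_def disjoint_def)
    qed
    ultimately have "(B - {m}, P - {B}) \<in> ?D" by simp
    moreover have "P = ?f (B - {m}, P - {B})"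
      using B by (simp add: insert_absorb)
    ultimately show "P \<in> ?f ` ?D" by blast
  qed
  have "card {P. partition_on (insert m S) P} = card ?D"
    using card_image[OF inj] unfolding img .
  also have "\<dots> = (\<Sum>A\<in>Pow S. card {P. partition_on (S - A) P})"
    using assms(1) by (subst card_SigmaI) (auto intro: finitely_many_partition_on)
  finally show ?thesis .
qed

text \<open>Both counts are 1 on the empty set, and the two recursions agree term by term under
  strong induction over proper subsets.\<close>

lemma card_avoiders:
  assumes "finite S"
  shows "card (avoiders S) = card {P. partition_on S P}"
  using assms
proof (induction S rule: finite_psubset_induct)
  case (psubset S)
  show ?case
  proof (cases "S = {}")
    case True
    then show ?thesis
      by (simp add: avoiders_def partition_on_empty Collect_conv_if)
  next
    case False
    define m where "m = Max S"
    define T where "T = S - {m}"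
    have "m \<in> S"
      unfolding m_def using psubset.hyps False by (rule Max_in)
    then have S: "S = insert m T" and T: "finite T" "\<forall>x\<in>T. x < m" "m \<notin> T"
      using psubset.hyps Max_ge[of S] by (auto simp: m_def T_def order.strict_iff_order)
    \<comment> \<open>\<open>T - A\<close> lacks \<open>m\<close>, hence is a proper subset of
      \<open>S\<close> even for empty \<open>A\<close>.\<close>
    have "card (avoiders (T - A)) = card {P. partition_on (T - A) P}" for A
      using T(3) by (intro psubset.IH) (auto simp: S)
    then show ?thesis
      unfolding S by (simp add: card_avoiders_rec card_partition_on_rec T)
  qed
qed

lemma card_avoiders_Bell: "card (avoiders {1..n}) = Bell n"
  by (simp add: card_avoiders Bell_def)

section \<open>Initial patterns and the final count\<close>

lemma begins_with_single_iff: "begins_with xs [a] \<longleftrightarrow> xs \<noteq> []"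
  by (cases xs) (auto simp: begins_with_def order_isomorphic_def)

lemma begins_with_12_iff: "begins_with xs [1, 2] \<longleftrightarrow> (\<exists>x y zs. xs = x # y # zs \<and> x < y)"
proof (cases xs rule: remdups_adj.cases)
  case (3 x y zs)
  then show ?thesis
    by (auto simp: begins_with_def order_isomorphic_def less_Suc_eq numeral_2_eq_2)
qed (auto simp: begins_with_def)

text \<open>The last three letters 2, 1, \<open>k\<close> of the pattern are themselves ordered like
  213, and order isomorphism transfers this to \<open>xs\<close>.\<close>

lemma begins_with_decreasing_then_max_imp_contains_21_3:
  assumes "k \<ge> 3" and "begins_with xs (decreasing_then_max k)"
  shows "contains_21_3 xs"
proof -
  define p where "p = decreasing_then_max k"
  have len: "length p = k"
    using assms(1) by (simp add: p_def decreasing_then_max_def)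
  have p: "p ! (k - 3) = 2" "p ! (k - 2) = 1" "p ! (k - 1) = k"
    using assms(1) by (auto simp: p_def decreasing_then_max_def nth_append rev_nth)
  have k: "k \<le> length xs" and "order_isomorphic (take k xs) p"
    using assms(2) len by (auto simp: begins_with_def p_def)
  then have *: "xs ! i < xs ! j \<longleftrightarrow> p ! i < p ! j" if "i < k" "j < k" for i j
    using that by (simp add: order_isomorphic_def)
  have "xs ! (k - 2) < xs ! (k - 3)" "xs ! (k - 3) < xs ! (k - 1)"
    using assms(1) p *[of "k - 2" "k - 3"] *[of "k - 3" "k - 1"] by simp_all
  moreover have "k - 3 + 1 = k - 2"
    using assms(1) by simp
  ultimately show ?thesis
    using assms(1) k unfolding contains_21_3_iff
    by (intro exI[of _ "k - 3"] exI[of _ "k - 1"]) auto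
qed

text \<open>For \<open>n = 1\<close> there is no second letter, so the single avoider counts as not starting with
  an ascent.\<close>

lemma avoiders_not_begins_with_12:
  assumes "n \<ge> 1"
  shows "{xs \<in> avoiders {1..n}. \<not> begins_with xs [1, 2]} = (#) n ` avoiders {1..n - 1}"
proof (intro equalityI subsetI)
  fix xs assume "xs \<in> {xs \<in> avoiders {1..n}. \<not> begins_with xs [1, 2]}"
  then have dist: "distinct xs" and set: "set xs = {1..n}" and av: "\<not> contains_21_3 xs"
    and nasc: "\<not> begins_with xs [1, 2]"
    by (auto simp: avoiders_def permutations_of_set_def)
  obtain x ys where xs: "xs = x # ys"
    using set assms by (cases xs) auto
  \<comment> \<open>The first letter exceeds the second, if there is one, so a later letter above
    \<open>x\<close> would complete a 21-3.\<close>
  have "x \<ge> y" if "y \<in> set xs" for y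
  proof (cases ys)
    case Nil
    then show ?thesis
      using that xs by simp
  next
    case (Cons z zs)
    then show ?thesis
      using that xs av nasc dist
      by (force simp: begins_with_12_iff contains_21_3_Cons_Cons not_less simp del: One_nat_def)
  qed
  moreover have "n \<in> set xs"
    using set assms by simp
  moreover have "x \<in> set xs"
    by (simp add: xs)
  ultimately have x: "x = n"
    using set by (metis atLeastAtMost_iff order_antisym)
  have "n \<notin> set ys"
    using dist by (simp add: xs x)
  then have "set ys = set xs - {n}"
    by (simp add: xs x)
  also have "\<dots> = {1..n - 1}"
    unfolding set by auto
  finally have ys: "set ys = {1..n - 1}" .
  with assms have "\<forall>y\<in>set ys. y < n" by auto
  then have "ys \<in> avoiders {1..n - 1}"
    using av dist ys by (auto simp: xs x avoiders_def permutations_of_set_def contains_21_3_max_Cons)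
  then show "xs \<in> (#) n ` avoiders {1..n - 1}"
    by (simp add: xs x)
next
  fix xs assume "xs \<in> (#) n ` avoiders {1..n - 1}"
  then obtain ys where xs: "xs = n # ys" and "distinct ys" "\<not> contains_21_3 ys"
    and set: "set ys = {1..n - 1}"
    by (auto simp: avoiders_def permutations_of_set_def)
  moreover from set assms have less: "\<forall>y\<in>set ys. y < n" by auto
  moreover have "\<not> begins_with xs [1, 2]"
    using less by (force simp: begins_with_12_iff xs simp del: One_nat_def)
  moreover have "insert n {1..n - 1} = {1..n}"
    using assms by auto
  ultimately show "xs \<in> {xs \<in> avoiders {1..n}. \<not> begins_with xs [1, 2]}"
    by (auto simp: avoiders_def permutations_of_set_def contains_21_3_max_Cons)
qed

theorem proposition18:
  fixes k n :: nat
  assumes "k \<ge> 1" and "n \<ge> 1"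
  shows "int (N_21_3 (decreasing_then_max k) n) =
    (if k \<ge> 3 then 0
     else if k = 2 then int (Bell n) - int (Bell (n - 1))
     else int (Bell n))"
proof -
  have N: "N_21_3 p n = card {xs \<in> avoiders {1..n}. begins_with xs p}" for p
    by (simp add: N_21_3_def avoiders_def conj_assoc)
  consider "k \<ge> 3" | "k = 2" | "k = 1"
    using assms(1) by linarith
  then show ?thesis
  proof cases
    case 1
    then have "{xs \<in> avoiders {1..n}. begins_with xs (decreasing_then_max k)} = {}"
      by (auto simp: avoiders_def dest: begins_with_decreasing_then_max_imp_contains_21_3)
    with 1 show ?thesis
      by (simp add: N)
  next
    case 2
    let ?A = "{xs \<in> avoiders {1..n}. begins_with xs [1, 2]}"
    let ?B = "{xs \<in> avoiders {1..n}. \<not> begins_with xs [1, 2]}"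
    \<comment> \<open>Initial ascents are counted through the complement \<open>?B\<close>, which
      deleting the leading \<open>n\<close> maps bijectively to the avoiders on
      \<open>{1..n - 1}\<close>.\<close>
    have "avoiders {1..n} = ?A \<union> ?B" by blast
    then have "card (avoiders {1..n}) = card (?A \<union> ?B)" by simp
    also have "\<dots> = card ?A + card ?B"
      by (rule card_Un_disjoint) auto
    also have "card ?B = card (avoiders {1..n - 1})"
      by (simp only: avoiders_not_begins_with_12[OF assms(2)]) (simp add: card_image)
    \<comment> \<open>The additive form over \<open>nat\<close> gives the difference of Bell numbers
      over \<open>int\<close> without truncation.\<close>
    finally have "Bell n = card ?A + Bell (n - 1)"
      by (simp only: card_avoiders_Bell)
    with 2 show ?thesis
      by (simp only: N decreasing_then_max_small) simp
  next
    case 3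
    \<comment> \<open>Since \<open>n\<close> is positive, every avoider is nonempty and so begins
      with the pattern 1.\<close>
    have "{xs \<in> avoiders {1..n}. begins_with xs [1]} = avoiders {1..n}"
      using assms(2)
      by (auto simp: begins_with_single_iff avoiders_def permutations_of_set_def)
    with 3 show ?thesis
      by (simp only: N decreasing_then_max_small card_avoiders_Bell) simp
  qed
qed

end
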